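(* For every integer $s\ge 1$, the degree-maximizing partitions of $T_s+1$ (those $\lambda\vdash T_s+1$ with $\deg(\lambda)=\Delta_{T_s+1}$) are exactly $$(s+1,s-1,s-2,\dots,1)\qquad\text{and}\qquad (s,s-1,\dots,2,1^2).$$ In particular, there are exactly $2$ degree-maximizing partitions of $T_s+1$.
   Context: For an integer $m\ge 0$, $T_m:=m(m+1)/2$. Exponents denote multiplicities. The first partition is the staircase $(s,s-1,\dots,1)$ with its largest part increased by $1$; the second is the staircase with an additional part $1$ (for $s=1$ these are $(2)$ and $(1^2)$). Partition graph: for $n\ge 1$, $G_n$ is the simple graph whose vertices are the integer partitions of $n$; two distinct partitions are adjacent if one is obtained from the other by an elementary transfer of one unit from one part to another (subtract $1$ from one part and add $1$ to another part), followed by reordering. Here the receiving part may be a zero part (so a new part $1$ may be created), and parts that become $0$ are discarded. $\deg(\lambda)$ is the degree of $\lambda$ in $G_n$, and $\Delta_n:=\max_{\lambda\vdash n}\deg(\lambda)$. *)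

theory Defs
  imports "HOL-Library.Multiset"
begin

text \<open>An integer partition is the multiset of its (positive) parts.\<close>

definition partitions :: "nat \<Rightarrow> nat multiset set" where
  "partitions n = {p. 0 \<notin># p \<and> \<Sum>\<^sub># p = n}"

text \<open>
  Elementary transfer of one unit from a part \<open>a\<close> to another part \<open>b\<close>; the multiset \<open>r\<close>
  collects the untouched parts. The partition is padded with one zero part, so that \<open>b = 0\<close> is
  always allowed; zero parts are discarded afterwards. Equal values \<open>a = b\<close> are
  possible only if that value occurs at least twice.
\<close>

definition transfer_step :: "nat multiset \<Rightarrow> nat multiset \<Rightarrow> bool" where
  "transfer_step p q \<longleftrightarrow>
     (\<exists>a b r. a \<ge> 1 \<and> add_mset 0 p = add_mset a (add_mset b r) \<and>
              q = filter_mset (\<lambda>x. x > 0) (add_mset (a - 1) (add_mset (b + 1) r)))"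

definition partition_adj :: "nat multiset \<Rightarrow> nat multiset \<Rightarrow> bool" where
  "partition_adj p q \<longleftrightarrow> p \<noteq> q \<and> (transfer_step p q \<or> transfer_step q p)"

text \<open>The degree of \<open>p\<close> in the graph on \<open>partitions n\<close> with adjacency \<open>partition_adj\<close>.\<close>

definition partition_deg :: "nat \<Rightarrow> nat multiset \<Rightarrow> nat" where
  "partition_deg n p = card {q \<in> partitions n. partition_adj p q}"

definition max_partition_deg :: "nat \<Rightarrow> nat" where
  "max_partition_deg n = Max (partition_deg n ` partitions n)"

definition degree_maximizing :: "nat \<Rightarrow> nat multiset set" where
  "degree_maximizing n = {p \<in> partitions n. partition_deg n p = max_partition_deg n}"

definition triangular :: "nat \<Rightarrow> nat" where
  "triangular m = m * (m + 1) div 2"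

text \<open>The partitions \<open>(s + 1, s - 1, s - 2, \<dots>, 1)\<close> and \<open>(s, s - 1, \<dots>, 2, 1, 1)\<close>, for \<open>s \<ge> 1\<close>.\<close>

definition staircase_top :: "nat \<Rightarrow> nat multiset" where
  "staircase_top s = add_mset (s + 1) (mset_set {1..<s})"

definition staircase_one :: "nat \<Rightarrow> nat multiset" where
  "staircase_one s = add_mset 1 (mset_set {1..s})"

text \<open>Finiteness and nonemptiness make the maximum and the cardinalities above meaningful.\<close>

lemma finite_partitions: "finite (partitions n)"
proof (rule finite_subset)
  show "partitions n \<subseteq> mset ` {xs. set xs \<subseteq> {..n} \<and> length xs \<le> n}"
  proof
    fix p assume p: "p \<in> partitions n"
    obtain xs where xs: "p = mset xs" by (metis ex_mset)
    have "x \<le> n" if "x \<in> set xs" for x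
      using p xs that member_le_sum_list[of x xs] by (auto simp: partitions_def sum_mset_sum_list)
    moreover have "length xs \<le> sum_list xs" if "0 \<notin> set xs" for xs :: "nat list"
      using that by (induction xs) auto
    ultimately show "p \<in> mset ` {xs. set xs \<subseteq> {..n} \<and> length xs \<le> n}"
      using p xs by (auto simp: partitions_def sum_mset_sum_list)
  qed
  show "finite (mset ` {xs. set xs \<subseteq> {..n} \<and> length xs \<le> n})"
    by (intro finite_imageI finite_lists_length_le) auto
qed

lemma partitions_nonempty: "partitions n \<noteq> {}"
proof -
  have "replicate_mset n 1 \<in> partitions n"
    by (auto simp: partitions_def)
  then show ?thesis by blast
qed

end

theory Submission
  imports Defs
begin

text \<open>
  Let \<open>D\<close> be the set of parts of a partition \<open>p\<close> and \<open>d\<close> its cardinality. A transfer from \<open>a\<close> to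
  \<open>b\<close> changes the conjugate partition (the numbers of parts \<open>\<ge> k\<close>) by \<open>-1\<close> at \<open>k = a\<close> and \<open>+1\<close> at
  \<open>k = b + 1\<close>. Hence it is trivial only for \<open>a = b + 1\<close>, and different nontrivial pairs \<open>(a, b)\<close>
  give different neighbours. So the degree is \<open>d (d + 1)\<close>, minus the number of \<open>a \<in> D\<close> with
  \<open>a - 1 \<in> D \<union> {0}\<close>, minus the number of parts of multiplicity one. For \<open>n = T\<^sub>s + 1\<close> one has
  \<open>d \<le> s\<close>; if \<open>d < s\<close> the degree is at most \<open>s (s - 1)\<close>, and \<open>d = s\<close> leaves just the two
  partitions of the theorem, which both have degree \<open>s (s - 1) + 1\<close>.
\<close>

section \<open>Nontrivial transfers as pairs of values\<close>

definition moves :: "nat multiset \<Rightarrow> (nat \<times> nat) set" where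
  "moves p = {(a, b). a \<in># p \<and> b \<in> insert 0 (set_mset p) \<and> a \<noteq> b + 1 \<and> (a = b \<longrightarrow> count p a \<ge> 2)}"

text \<open>The difference \<open>add_mset 0 p - {#a, b#}\<close> recovers the untouched parts
  \<open>r\<close> of \<open>transfer_step\<close>, so a neighbour depends on the pair of values
  alone.\<close>

definition move :: "nat multiset \<Rightarrow> nat \<times> nat \<Rightarrow> nat multiset" where
  "move p = (\<lambda>(a, b). filter_mset (\<lambda>x. x > 0)
     (add_mset (a - 1) (add_mset (b + 1) (add_mset 0 p - {#a, b#}))))"

lemma filter_mset_pos_eq: "0 \<notin># p \<Longrightarrow> filter_mset (\<lambda>x. x > 0) p = (p :: nat multiset)"
  by (induction p) auto

text \<open>The unit travels back from \<open>b + 1\<close> to \<open>a - 1\<close>. Hence adjacency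
  reduces to one direction of \<open>transfer_step\<close>.\<close>

lemma transfer_step_sym:
  assumes "0 \<notin># p" and "transfer_step p q"
  shows "transfer_step q p"
proof -
  obtain a b r where a: "a \<ge> 1" and p: "add_mset 0 p = add_mset a (add_mset b r)"
    and q: "q = filter_mset (\<lambda>x. x > 0) (add_mset (a - 1) (add_mset (b + 1) r))"
    using assms(2) unfolding transfer_step_def by blast
  define r' where "r' = filter_mset (\<lambda>x. x > 0) r"
  have fp: "p = filter_mset (\<lambda>x. x > 0) (add_mset 0 p)"
    using assms(1) by (simp add: filter_mset_pos_eq)
  have p': "p = filter_mset (\<lambda>x. x > 0) (add_mset (b + 1 - 1) (add_mset (a - 1 + 1) r'))"
    using a by (subst fp, subst p) (simp add: r'_def filter_filter_mset add_mset_commute)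
  have p'': "p = filter_mset (\<lambda>x. x > 0)
      (add_mset (b + 1 - 1) (add_mset (a - 1 + 1) (add_mset 0 r')))"
    by (subst p') simp
  have b: "b + 1 \<ge> 1"
    by simp
  show ?thesis
  \<comment> \<open>For \<open>a = 1\<close> the emptied part itself serves as the padding zero of
    \<open>q\<close>; otherwise a fresh zero joins \<open>r'\<close>.\<close>
  proof (cases "a = 1")
    case True
    then have "add_mset 0 q = add_mset (b + 1) (add_mset (a - 1) r')"
      by (simp add: q r'_def)
    with b p' show ?thesis
      unfolding transfer_step_def by blast
  next
    case False
    with a have "add_mset 0 q = add_mset (b + 1) (add_mset (a - 1) (add_mset 0 r'))"
      by (simp add: q r'_def add_mset_commute)
    with b p'' show ?thesis
      unfolding transfer_step_def by blast
  qed
qed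

lemma sum_mset_filter_pos: "\<Sum>\<^sub># (filter_mset (\<lambda>x. x > 0) p) = \<Sum>\<^sub># (p :: nat multiset)"
  by (induction p) auto

lemma transfer_step_partitions:
  assumes "p \<in> partitions n" and "transfer_step p q"
  shows "q \<in> partitions n"
proof -
  obtain a b r where a: "a \<ge> 1" and p: "add_mset 0 p = add_mset a (add_mset b r)"
    and q: "q = filter_mset (\<lambda>x. x > 0) (add_mset (a - 1) (add_mset (b + 1) r))"
    using assms(2) unfolding transfer_step_def by blast
  have "\<Sum>\<^sub># q = \<Sum>\<^sub># (add_mset a (add_mset b r))"
    unfolding q sum_mset_filter_pos using a by simp
  also have "\<dots> = n"
    unfolding p[symmetric] using assms(1) by (simp add: partitions_def)
  finally show ?thesis
    by (auto simp: q partitions_def)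
qed

lemma moves_split:
  assumes "0 \<notin># p" and "(a, b) \<in> moves p"
  shows "add_mset 0 p = add_mset a (add_mset b (add_mset 0 p - {#a, b#}))"
proof -
  \<comment> \<open>Multiset subtraction truncates, so both values must really be available: the
    padding covers \<open>b = 0\<close>, and the multiplicity clause of \<open>moves\<close> covers
    \<open>a = b\<close>.\<close>
  have "{#a, b#} \<subseteq># add_mset 0 p"
    using assms by (auto simp: moves_def subseteq_mset_def not_in_iff)
  then have "add_mset 0 p = {#a, b#} + (add_mset 0 p - {#a, b#})"
    by (rule subset_mset.add_diff_inverse[symmetric])
  also have "\<dots> = add_mset a (add_mset b (add_mset 0 p - {#a, b#}))"
    by (simp only: union_mset_add_mset_left add_0)
  finally show ?thesis .
qed

text \<open>These sizes are the parts of the conjugate partition. Lowering \<open>a\<close> affects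
  only the threshold \<open>k = a\<close>, raising \<open>b\<close> only \<open>k = b + 1\<close>;
  zero parts are invisible because \<open>k \<ge> 1\<close>.\<close>

lemma size_filter_transfer:
  fixes a b k :: nat
  assumes "a \<ge> 1" and p: "add_mset 0 p = add_mset a (add_mset b r)" and "k \<ge> 1"
  shows "int (size (filter_mset (\<lambda>x. k \<le> x)
            (filter_mset (\<lambda>x. x > 0) (add_mset (a - 1) (add_mset (b + 1) r))))) =
         int (size (filter_mset (\<lambda>x. k \<le> x) p)) + of_bool (k = b + 1) - of_bool (k = a)"
proof -
  have "size (filter_mset (\<lambda>x. k \<le> x) p) = size (filter_mset (\<lambda>x. k \<le> x) (add_mset 0 p))"
    using assms(3) by simp
  also have "\<dots> = size (filter_mset (\<lambda>x. k \<le> x) (add_mset a (add_mset b r)))"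
    by (simp only: p)
  finally have *: "size (filter_mset (\<lambda>x. k \<le> x) p) =
      size (filter_mset (\<lambda>x. k \<le> x) (add_mset a (add_mset b r)))" .
  have "filter_mset (\<lambda>x. k \<le> x) (filter_mset (\<lambda>x. x > 0) r) = filter_mset (\<lambda>x. k \<le> x) r"
    using assms(3) by (auto simp: filter_filter_mset intro!: filter_mset_cong)
  then show ?thesis
    unfolding * using assms(1,3) by (auto split: if_splits)
qed

lemma size_filter_move:
  assumes "0 \<notin># p" and "(a, b) \<in> moves p" and "k \<ge> 1"
  shows "int (size (filter_mset (\<lambda>x. k \<le> x) (move p (a, b)))) =
         int (size (filter_mset (\<lambda>x. k \<le> x) p)) + of_bool (k = b + 1) - of_bool (k = a)"
proof -
  have "a \<ge> 1"
    using assms(1,2) by (auto simp: moves_def Suc_le_eq intro: gr0I)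
  then show ?thesis
    using size_filter_transfer[OF _ moves_split[OF assms(1,2)] assms(3)]
    by (simp add: move_def)
qed

lemma inj_on_move:
  assumes "0 \<notin># p"
  shows "inj_on (move p) (moves p)"
proof (rule inj_onI, clarify)
  fix a b a' b'
  assume m: "(a, b) \<in> moves p" "(a', b') \<in> moves p" and eq: "move p (a, b) = move p (a', b')"
  have pos: "a \<ge> 1" "a' \<ge> 1" and ne: "a \<noteq> b + 1" "a' \<noteq> b' + 1"
    using assms m by (auto simp: moves_def Suc_le_eq intro: gr0I)
  have *: "of_bool (k = b + 1) - of_bool (k = a) = (of_bool (k = b' + 1) - of_bool (k = a') :: int)"
    if "k \<ge> 1" for k
    using size_filter_move[OF assms m(1) that] size_filter_move[OF assms m(2) that] eq by simp
  show "a = a' \<and> b = b'"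
    \<comment> \<open>As \<open>a \<noteq> b + 1\<close>, the changes -1 and +1 do not cancel;
      evaluating at these two positions reads off \<open>a\<close> and \<open>b\<close>.\<close>
    using *[OF pos(1)] *[of "b + 1"] pos ne by (auto simp: of_bool_def split: if_splits)
qed

lemma neighbours_eq_moves:
  assumes "p \<in> partitions n"
  shows "{q \<in> partitions n. partition_adj p q} = move p ` moves p"
proof (intro equalityI subsetI)
  have z: "0 \<notin># p"
    using assms by (simp add: partitions_def)
  fix q assume q: "q \<in> {q \<in> partitions n. partition_adj p q}"
  then have "0 \<notin># q" "p \<noteq> q" "transfer_step p q \<or> transfer_step q p"
    by (auto simp: partitions_def partition_adj_def)
  then have "transfer_step p q" and ne: "p \<noteq> q"
    using transfer_step_sym by blast+
  then obtain a b r where a: "a \<ge> 1" and p: "add_mset 0 p = add_mset a (add_mset b r)"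
    and q': "q = filter_mset (\<lambda>x. x > 0) (add_mset (a - 1) (add_mset (b + 1) r))"
    unfolding transfer_step_def by blast
  have r: "r = add_mset 0 p - {#a, b#}"
    by (simp add: p)
  have "a \<noteq> b + 1"
  proof
    \<comment> \<open>Such a transfer merely swaps the two values.\<close>
    assume "a = b + 1"
    then have "q = filter_mset (\<lambda>x. x > 0) (add_mset 0 p)"
      by (simp add: q' p add_mset_commute)
    with z have "q = p"
      by (simp add: filter_mset_pos_eq)
    with ne show False by simp
  qed
  moreover have "a \<in> insert 0 (set_mset p)" "b \<in> insert 0 (set_mset p)"
    using arg_cong[OF p, of set_mset] by auto
  then have "a \<in># p" "b \<in> insert 0 (set_mset p)"
    using a by auto
  moreover have "count p a \<ge> 2" if "a = b"
    using that a arg_cong[OF p, of "\<lambda>m. count m a"] by auto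
  ultimately have "(a, b) \<in> moves p"
    by (simp add: moves_def)
  moreover have "q = move p (a, b)"
    by (simp add: move_def q' r)
  ultimately show "q \<in> move p ` moves p"
    by blast
next
  have z: "0 \<notin># p"
    using assms by (simp add: partitions_def)
  fix q assume "q \<in> move p ` moves p"
  then obtain a b where ab: "(a, b) \<in> moves p" and q: "q = move p (a, b)"
    by auto
  have a: "a \<ge> 1"
    using z ab by (auto simp: moves_def Suc_le_eq intro: gr0I)
  have "transfer_step p q"
    unfolding transfer_step_def q move_def prod.case using a moves_split[OF z ab] by blast
  \<comment> \<open>The number of parts \<open>\<ge> a\<close> drops by one.\<close>
  moreover have "p \<noteq> q"
    using size_filter_move[OF z ab a] q ab by (auto simp: moves_def)
  ultimately show "q \<in> {q \<in> partitions n. partition_adj p q}"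
    using transfer_step_partitions[OF assms] by (auto simp: partition_adj_def)
qed

section \<open>Degree formula\<close>

lemma partition_deg_eq_card_moves:
  assumes "p \<in> partitions n"
  shows "partition_deg n p = card (moves p)"
proof -
  have "0 \<notin># p"
    using assms by (simp add: partitions_def)
  then show ?thesis
    unfolding partition_deg_def neighbours_eq_moves[OF assms] by (rule card_image[OF inj_on_move])
qed

lemma card_moves_le:
  assumes "0 \<notin># p"
  shows "card (moves p) \<le> card (set_mset p) * (card (set_mset p) + 1)"
proof -
  have "moves p \<subseteq> set_mset p \<times> insert 0 (set_mset p)"
    by (auto simp: moves_def)
  then have "card (moves p) \<le> card (set_mset p \<times> insert 0 (set_mset p))"
    by (intro card_mono) auto
  then show ?thesis
    using assms by (simp add: card_cartesian_product)
qed

text \<open>The product of \<open>?D\<close> and \<open>insert 0 ?D\<close> splits into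
  \<open>moves p\<close>, the trivial pairs \<open>(a, a - 1)\<close> and the diagonal pairs of
  parts occurring once. Positivity of the parts keeps the last two classes disjoint.\<close>

lemma card_moves:
  assumes "0 \<notin># p"
  shows "card (moves p) + card {a \<in> set_mset p. a - 1 \<in> insert 0 (set_mset p)}
           + card {a \<in> set_mset p. count p a = 1}
         = card (set_mset p) * (card (set_mset p) + 1)"
proof -
  let ?D = "set_mset p"
  let ?A = "{a \<in> ?D. a - 1 \<in> insert 0 ?D}" and ?S = "{a \<in> ?D. count p a = 1}"
  let ?A' = "(\<lambda>a. (a, a - 1)) ` ?A" and ?S' = "(\<lambda>a. (a, a)) ` ?S"
  have pos: "a > 0" if "a \<in># p" for a
    using assms that by (auto intro: gr0I)
  have c1: "count p a = 1 \<longleftrightarrow> \<not> count p a \<ge> 2" if "a \<in># p" for a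
  proof -
    have "count p a > 0" using that by simp
    then show ?thesis by linarith
  qed
  have "?D \<times> insert 0 ?D = moves p \<union> ?A' \<union> ?S'"
    using assms c1 by (auto simp: moves_def image_iff)
  moreover have "moves p \<inter> ?A' = {}" "(moves p \<union> ?A') \<inter> ?S' = {}"
    using pos by (auto simp: moves_def) (use pos in force)+
  moreover have "finite (moves p)"
    by (rule finite_subset[of _ "?D \<times> insert 0 ?D"]) (auto simp: moves_def)
  ultimately have "card (?D \<times> insert 0 ?D) = card (moves p) + card ?A' + card ?S'"
    by (simp add: card_Un_disjoint)
  moreover have "card ?A' = card ?A" "card ?S' = card ?S"
    by (intro card_image inj_onI; simp)+
  ultimately show ?thesis
    using assms by (simp add: card_cartesian_product)
qed

section \<open>Sets of positive integers with small sum\<close>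

lemma triangular_Suc: "triangular (Suc m) = triangular m + Suc m"
  by (simp add: triangular_def)

lemma sum_atLeastAtMost_triangular: "\<Sum>{1..m} = triangular m"
  by (induction m) (simp_all add: triangular_Suc, simp add: triangular_def)

text \<open>Induction deletes the maximum, which is at least the cardinality since \<open>D\<close>
  lies in \<open>{1..Max D}\<close>.\<close>

lemma triangular_card_le_sum:
  fixes D :: "nat set"
  assumes "finite D" and "0 \<notin> D"
  shows "triangular (card D) \<le> \<Sum>D"
  using assms
proof (induction "card D" arbitrary: D)
  case 0
  then show ?case by (simp add: triangular_def)
next
  case (Suc m)
  let ?M = "Max D"
  have M: "?M \<in> D"
    using Suc.hyps(2) Suc.prems by (metis Max_in card.empty nat.distinct(1))
  have "D \<subseteq> {1..?M}"
    using Suc.prems by (auto simp: Suc_le_eq intro: gr0I)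
  then have "Suc m \<le> ?M"
    using card_mono[of "{1..?M}" D] Suc.hyps(2) by simp
  moreover have "triangular m \<le> \<Sum>(D - {?M})"
    using Suc.hyps(1)[of "D - {?M}"] Suc.hyps(2)[symmetric] Suc.prems M by simp
  moreover have "\<Sum>D = ?M + \<Sum>(D - {?M})"
    using sum.remove[of D ?M "\<lambda>x. x"] Suc.prems M by simp
  ultimately show ?case
    using Suc.hyps(2)[symmetric] by (simp add: triangular_Suc)
qed

lemma near_staircase_sets:
  fixes D :: "nat set"
  assumes "finite D" and "0 \<notin> D" and "card D = s" and "s \<ge> 1" and sum: "\<Sum>D \<le> triangular s + 1"
  shows "D = {1..s} \<or> D = insert (s + 1) {1..<s}"
proof -
  have "x \<le> s + 1" if x: "x \<in> D" for x
  proof -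
    \<comment> \<open>The other \<open>s - 1\<close> elements already use up
      \<open>triangular (s - 1)\<close>, leaving at most \<open>s + 1\<close> for
      \<open>x\<close>.\<close>
    have "triangular (s - 1) \<le> \<Sum>(D - {x})"
      using triangular_card_le_sum[of "D - {x}"] assms x by simp
    moreover have "\<Sum>D = x + \<Sum>(D - {x})"
      using sum.remove[of D x "\<lambda>x. x"] assms x by simp
    moreover have "triangular s = triangular (s - 1) + s"
      using triangular_Suc[of "s - 1"] assms(4) by simp
    ultimately show ?thesis
      using sum by linarith
  qed
  then have sub: "D \<subseteq> {1..s + 1}"
    using assms(2) by (auto simp: Suc_le_eq intro: gr0I)
  then have "card ({1..s + 1} - D) = 1"
    using assms by (simp add: card_Diff_subset)
  then obtain x where x: "{1..s + 1} - D = {x}"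
    by (rule card_1_singletonE)
  have D: "D = {1..s + 1} - {x}" and x': "x \<in> {1..s + 1}"
    using x sub by auto
  \<comment> \<open>The one omitted number is the difference of the sums, at least
    \<open>triangular (s + 1) - triangular s - 1 = s\<close>.\<close>
  have "\<Sum>{1..s + 1} = x + \<Sum>D"
    unfolding D using sum.remove[of "{1..s + 1}" x "\<lambda>x. x"] x' by simp
  then have "s \<le> x"
    using sum sum_atLeastAtMost_triangular[of "s + 1"] triangular_Suc[of s] by simp
  then have "x = s \<or> x = s + 1"
    using x' by auto
  then show ?thesis
    unfolding D using assms(4) by auto
qed

text \<open>One copy of each distinct part is split off; \<open>r\<close> holds the
  repetitions.\<close>

lemma mset_eq_mset_set_plus:
  obtains r where "p = mset_set (set_mset p) + r" "set_mset r \<subseteq> set_mset p"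
proof
  have "mset_set (set_mset p) \<subseteq># p"
    by (simp add: subseteq_mset_def count_mset_set')
  then show "p = mset_set (set_mset p) + (p - mset_set (set_mset p))"
    by simp
  show "set_mset (p - mset_set (set_mset p)) \<subseteq> set_mset p"
    by (meson in_diffD subsetI)
qed

section \<open>Classification by the number of distinct parts\<close>

lemma partition_cases:
  assumes "s \<ge> 1" and p: "p \<in> partitions (triangular s + 1)"
  shows "card (set_mset p) < s \<or> p = staircase_top s \<or> p = staircase_one s"
proof -
  let ?D = "set_mset p"
  obtain r where r: "p = mset_set ?D + r" "set_mset r \<subseteq> ?D"
    by (rule mset_eq_mset_set_plus)
  have z: "0 \<notin># p" and "\<Sum>\<^sub># p = triangular s + 1"
    using p by (auto simp: partitions_def)
  moreover have "\<Sum>\<^sub># p = \<Sum>?D + \<Sum>\<^sub># r"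
    by (subst r(1)) (simp add: sum_unfold_sum_mset)
  ultimately have sum: "\<Sum>?D + \<Sum>\<^sub># r = triangular s + 1"
    by simp
  have zr: "0 \<notin># r"
    using z r(2) by auto
  have "card ?D \<le> s"
  proof (rule ccontr)
    assume "\<not> card ?D \<le> s"
    then have "{1..Suc s} \<subseteq> {1..card ?D}"
      by auto
    then have "\<Sum>{1..Suc s} \<le> \<Sum>{1..card ?D}"
      by (intro sum_mono2) auto
    then have "triangular (Suc s) \<le> \<Sum>?D"
      using triangular_card_le_sum[of ?D] z by (simp only: sum_atLeastAtMost_triangular) simp
    then show False
      using sum assms(1) by (simp add: triangular_Suc)
  qed
  moreover have "p = staircase_top s \<or> p = staircase_one s" if c: "card ?D = s"
  proof -
    have "?D = {1..s} \<or> ?D = insert (s + 1) {1..<s}"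
      using near_staircase_sets[OF _ _ c assms(1)] z sum by simp
    then show ?thesis
    proof
      assume D: "?D = {1..s}"
      \<comment> \<open>The distinct parts miss the total by one, so the only repetition is a single
        1.\<close>
      then have "\<Sum>\<^sub># r = 1"
        using sum sum_atLeastAtMost_triangular[of s] by simp
      then obtain x r' where "r = add_mset x r'" "x + \<Sum>\<^sub># r' = 1" "x > 0" "0 \<notin># r'"
        using zr by (cases r) auto
      then have "r = {#1#}"
        by (cases r') auto
      with r(1) D have "p = mset_set {1..s} + {#1#}"
        by simp
      then show ?thesis
        by (simp add: staircase_one_def)
    next
      assume D: "?D = insert (s + 1) {1..<s}"
      have "\<Sum>{1..s} = s + \<Sum>{1..<s}"
        using assms(1) sum.last_plus[of 1 s "\<lambda>x. x"] by simp
      \<comment> \<open>Replacing \<open>s\<close> by \<open>s + 1\<close> already reaches the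
        total, so nothing is repeated.\<close>
      then have "\<Sum>?D = triangular s + 1"
        using D sum_atLeastAtMost_triangular[of s] by simp
      then have "\<Sum>\<^sub># r = 0"
        using sum by simp
      then have "r = {#}"
        using zr by (cases r) auto
      with r(1) D have "p = mset_set (insert (s + 1) {1..<s})"
        by simp
      then show ?thesis
        by (simp add: staircase_top_def)
    qed
  qed
  ultimately show ?thesis
    by linarith
qed

section \<open>Degrees of the two staircases and the maximum\<close>

lemma staircase_top_partition:
  assumes "s \<ge> 1"
  shows "staircase_top s \<in> partitions (triangular s + 1)"
proof -
  have "\<Sum>{1..s} = s + \<Sum>{1..<s}"
    using assms sum.last_plus[of 1 s "\<lambda>x. x"] by simp
  then show ?thesis
    using sum_atLeastAtMost_triangular[of s]
    by (simp add: partitions_def staircase_top_def sum_unfold_sum_mset)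
qed

lemma staircase_one_partition: "staircase_one s \<in> partitions (triangular s + 1)"
  using sum_atLeastAtMost_triangular[of s]
  by (simp add: partitions_def staircase_one_def sum_unfold_sum_mset)

text \<open>Only \<open>s + 1\<close> lacks its predecessor and no part repeats, so the count is
  \<open>s * (s + 1) - (s - 1) - s\<close>.\<close>

lemma card_moves_staircase_top:
  assumes "s \<ge> 1"
  shows "card (moves (staircase_top s)) = s * (s - 1) + 1"
proof -
  let ?p = "staircase_top s"
  have D: "set_mset ?p = insert (s + 1) {1..<s}" and z: "0 \<notin># ?p"
    by (auto simp: staircase_top_def)
  have c: "card (set_mset ?p) = s"
    using assms by (simp add: D)
  have "{a \<in> set_mset ?p. a - 1 \<in> insert 0 (set_mset ?p)} = {1..<s}"
    unfolding D using assms by auto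
  moreover have "{a \<in> set_mset ?p. count ?p a = 1} = set_mset ?p"
    unfolding D by (auto simp: staircase_top_def count_mset_set')
  ultimately show ?thesis
    using card_moves[OF z] c assms by (cases s) simp_all
qed

text \<open>Here every part has its predecessor (0 for the part 1) and only 1 repeats; the
  subtracted terms \<open>s - 1\<close> and \<open>s\<close> trade places.\<close>

lemma card_moves_staircase_one:
  assumes "s \<ge> 1"
  shows "card (moves (staircase_one s)) = s * (s - 1) + 1"
proof -
  let ?p = "staircase_one s"
  have D: "set_mset ?p = {1..s}" and z: "0 \<notin># ?p"
    using assms by (auto simp: staircase_one_def)
  have "{a \<in> set_mset ?p. a - 1 \<in> insert 0 (set_mset ?p)} = {1..s}"
    unfolding D by auto
  moreover have "{a \<in> set_mset ?p. count ?p a = 1} = {2..s}"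
    unfolding D by (auto simp: staircase_one_def count_mset_set' split: if_splits)
  ultimately show ?thesis
    using card_moves[OF z] D assms by (cases s) simp_all
qed

theorem proposition4p2:
  fixes s :: nat
  assumes "s \<ge> 1"
  shows "degree_maximizing (triangular s + 1) = {staircase_top s, staircase_one s} \<and>
         card (degree_maximizing (triangular s + 1)) = 2"
proof -
  let ?n = "triangular s + 1" and ?K = "s * (s - 1) + 1"
  note parts = staircase_top_partition[OF assms] staircase_one_partition[of s]
  have deg: "partition_deg ?n (staircase_top s) = ?K" "partition_deg ?n (staircase_one s) = ?K"
    using parts assms
    by (simp_all only: partition_deg_eq_card_moves card_moves_staircase_top
        card_moves_staircase_one)
  have small: "partition_deg ?n p < ?K"
    if p: "p \<in> partitions ?n" and ne: "p \<noteq> staircase_top s" "p \<noteq> staircase_one s" for p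
  proof -
    have "card (set_mset p) < s"
      using partition_cases[OF assms p] ne by blast
    \<comment> \<open>With at most \<open>s - 1\<close> distinct parts even the crude product bound
      stays one below \<open>?K\<close>.\<close>
    then have "card (set_mset p) * (card (set_mset p) + 1) \<le> (s - 1) * s"
      by (intro mult_mono) auto
    then show ?thesis
      using card_moves_le[of p] p
      by (simp add: partition_deg_eq_card_moves partitions_def mult.commute)
  qed
  have le: "partition_deg ?n p \<le> ?K" if "p \<in> partitions ?n" for p
    using small[OF that] deg by (metis order.refl less_imp_le)
  have "max_partition_deg ?n = ?K"
    unfolding max_partition_deg_def
  proof (rule Max_eqI)
    show "?K \<in> partition_deg ?n ` partitions ?n"
      using deg(1) parts(1) by (metis imageI)
  qed (use le finite_partitions in auto)
  then have eq: "degree_maximizing ?n = {staircase_top s, staircase_one s}"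
    unfolding degree_maximizing_def using parts deg small by fastforce
  have "s + 1 \<in># staircase_top s" "s + 1 \<notin># staircase_one s"
    using assms by (auto simp: staircase_top_def staircase_one_def)
  then have "staircase_top s \<noteq> staircase_one s"
    by metis
  with eq show ?thesis
    by simp
qed

end
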